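(* Let $\mu$ be a doubling measure in $\mathbb{R}^n$ and let $w\in L^1_{\mathrm{loc}}(\mathbb{R}^n,d\mu)$ be a weight. Suppose that for some increasing bijection $\Phi:[0,1]\to[0,1]$ and some constant $C>0$ \[ \frac{w\left(\bigcup_{j}Q_j\right)}{w(Q)}\le C\,\Phi^{-1}\left[\frac{\mu\left(\bigcup_{j}Q_j\right)}{\mu(Q)}\right] \] for every cube $Q$ and every countable family $\{Q_j\}_{j}$ of pairwise disjoint subcubes of $Q$. Then $w\in A_\infty(d\mu)$.
   Context: A (nontrivial, Borel, locally finite) measure $\mu$ on $\mathbb{R}^n$ is doubling if there are $c_\mu\ge1$, $n_\mu>0$ with $\mu(\tilde Q)\le c_\mu(\ell(\tilde Q)/\ell(Q))^{n_\mu}\mu(Q)$ for all cubes $Q\subset\tilde Q$, where $\ell$ is side length. A weight is a nonnegative locally integrable function, $w(E)=\int_Ew\,d\mu$, and it is assumed that $w(Q)>0$ for every cube $Q$. One says $w\in A_\infty(d\mu)$ if there exist $\delta,C'>0$ such that $\frac{w(E)}{w(Q)}\le C'\left(\frac{\mu(E)}{\mu(Q)}\right)^\delta$ for every cube $Q$ and every measurable $E\subset Q$. *)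

theory Defs
  imports "HOL-Analysis.Analysis"
begin

(* Cubes are half-open with sides parallel to the axes, so that the dyadic subcubes of a cube
   are again cubes and are pairwise disjoint as sets. *)
definition cube :: "real^'n \<Rightarrow> real \<Rightarrow> (real^'n) set" where
  "cube a l = {x. \<forall>i. a $ i \<le> x $ i \<and> x $ i < a $ i + l}"

definition is_cube :: "(real^'n) set \<Rightarrow> bool" where
  "is_cube Q \<longleftrightarrow> (\<exists>a l. l > 0 \<and> Q = cube a l)"

definition locally_finite_measure :: "(real^'n) measure \<Rightarrow> bool" where
  "locally_finite_measure M \<longleftrightarrow> (\<forall>x. \<exists>U. open U \<and> x \<in> U \<and> emeasure M U < \<infinity>)"

(* Cubes have finite measure by local finiteness, so the real-valued measure loses nothing. *)
definition doubling_measure :: "(real^'n) measure \<Rightarrow> bool" where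
  "doubling_measure M \<longleftrightarrow>
     sets M = sets borel \<and> emeasure M (space M) \<noteq> 0 \<and> locally_finite_measure M \<and>
     (\<exists>c \<nu> :: real. c \<ge> 1 \<and> \<nu> > 0 \<and>
       (\<forall>a l b m. l > 0 \<and> m > 0 \<and> cube a l \<subseteq> cube b m \<longrightarrow>
          measure M (cube b m) \<le> c * (m / l) powr \<nu> * measure M (cube a l)))"

definition locally_integrable :: "(real^'n) measure \<Rightarrow> (real^'n \<Rightarrow> real) \<Rightarrow> bool" where
  "locally_integrable M f \<longleftrightarrow>
     f \<in> borel_measurable M \<and> (\<forall>K. compact K \<longrightarrow> set_integrable M K f)"

definition wmeas :: "(real^'n) measure \<Rightarrow> (real^'n \<Rightarrow> real) \<Rightarrow> (real^'n) set \<Rightarrow> real" where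
  "wmeas M w E = (LINT x:E|M. w x)"

definition weight :: "(real^'n) measure \<Rightarrow> (real^'n \<Rightarrow> real) \<Rightarrow> bool" where
  "weight M w \<longleftrightarrow>
     (\<forall>x. w x \<ge> 0) \<and> locally_integrable M w \<and> (\<forall>Q. is_cube Q \<longrightarrow> wmeas M w Q > 0)"

definition A_infty :: "(real^'n) measure \<Rightarrow> (real^'n \<Rightarrow> real) set" where
  "A_infty M = {w. weight M w \<and>
     (\<exists>\<delta> C :: real. \<delta> > 0 \<and> C > 0 \<and>
       (\<forall>Q E. is_cube Q \<and> E \<in> sets M \<and> E \<subseteq> Q \<longrightarrow>
          wmeas M w E / wmeas M w Q \<le> C * (measure M E / measure M Q) powr \<delta>))}"

end

theory Submission imports Defs begin

text \<open>
  Write \<open>\<mu>\<close> for \<open>M\<close>, \<open>N\<close> for the measure with density \<open>w\<close> with respect to \<open>\<mu>\<close>, and \<open>\<phi>\<close> for the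
  inverse of \<open>\<Phi>\<close>. Since \<open>\<phi>\<close> tends to \<open>0\<close> at \<open>0\<close>, the hypothesis supplies a \<open>\<beta> > 0\<close> such that a
  disjoint union of subcubes filling at most the fraction \<open>\<beta>\<close> of the \<open>\<mu>\<close>-measure of a cube carries
  at most half of its \<open>N\<close>-measure. It remains to improve this one-step statement to a power law.

  The improvement is a Calderon-Zygmund iteration. Fix a cube \<open>Q\<close>, let \<open>D\<close> bound the ratio of the
  \<open>\<mu>\<close>-measures of a cube and of a subcube of half its side, and put \<open>\<lambda> = \<beta> / D\<close>. Let \<open>E\<close> be a union
  of dyadic subcubes of \<open>Q\<close> with \<open>\<mu>(E) \<le> \<lambda> \<mu>(Q)\<close>, and let \<open>E'\<close> be the union of the maximal dyadic
  subcubes in which \<open>E\<close> has density greater than \<open>\<lambda>\<close>. Each of them is a proper subcube whose parent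
  has density at most \<open>\<lambda>\<close>, so \<open>E\<close> has density at most \<open>D \<lambda> = \<beta>\<close> in it; hence \<open>N(E) \<le> N(E') / 2\<close>,
  while \<open>\<mu>(E') \<le> \<mu>(E) / \<lambda>\<close>. By repetition, \<open>\<mu>(E) \<le> \<lambda>^k \<mu>(Q)\<close> implies \<open>N(E) \<le> (1/2)^k N(Q)\<close>
  (\<open>decay_dyadically_open\<close>), which is a power law whose exponent is the logarithm of \<open>1/2\<close> to the
  base \<open>\<lambda>\<close> (\<open>power_decay_imp_powr\<close>).

  Only unions of dyadic cubes enter the iteration. Such a set contains a dyadic cube around each of
  its points, so \<open>E \<subseteq> E'\<close> holds exactly and not just up to a null set, and the Lebesgue
  differentiation theorem is avoided. General measurable sets are reached at the end by outer
  regularity (\<open>outer_open_approx\<close>), because the trace on \<open>Q\<close> of an open set is a union of dyadic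
  subcubes of \<open>Q\<close>.
\<close>

section \<open>Dyadic subcubes\<close>

text \<open>
  The half-open cube of side \<open>l / 2^k\<close> containing \<open>x\<close> in the grid through \<open>a\<close> that refines
  \<open>cube a l\<close> by \<open>k\<close> bisections. Naming a dyadic cube by one of its points makes the cells of one
  generation the classes of an equivalence relation, so that they partition the space by
  construction, and nestedness of generations becomes refinement of relations.
\<close>
definition dyadic_cell :: "real^'n \<Rightarrow> real \<Rightarrow> nat \<Rightarrow> real^'n \<Rightarrow> (real^'n) set" where
  "dyadic_cell a l k x = {y. \<forall>i. \<lfloor>2^k * (y $ i - a $ i) / l\<rfloor> = \<lfloor>2^k * (x $ i - a $ i) / l\<rfloor>}"

lemma dyadic_cell_self: "x \<in> dyadic_cell a l k x"
  by (simp add: dyadic_cell_def)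

lemma dyadic_cell_eq: "y \<in> dyadic_cell a l k x \<Longrightarrow> dyadic_cell a l k y = dyadic_cell a l k x"
  by (auto simp: dyadic_cell_def)

lemma dyadic_cell_eq_cube:
  assumes "l > 0"
  shows "dyadic_cell a l k x
    = cube (\<chi> i. a $ i + l * of_int \<lfloor>2^k * (x $ i - a $ i) / l\<rfloor> / 2^k) (l / 2^k)"
proof -
  have "\<lfloor>2^k * (y - b) / l\<rfloor> = m \<longleftrightarrow>
      b + l * of_int m / 2^k \<le> y \<and> y < b + l * of_int m / 2^k + l / 2^k"
    for y b :: real and m :: int
    unfolding floor_eq_iff using assms by (auto simp: field_simps)
  then show ?thesis
    by (auto simp: dyadic_cell_def cube_def)
qed

lemma dyadic_cell_Suc: "dyadic_cell a l (Suc k) x \<subseteq> dyadic_cell a l k x"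
proof -
  \<comment> \<open>The index of a cell determines that of its parent.\<close>
  have half: "\<lfloor>2^k * (t - b) / l\<rfloor> = \<lfloor>2^(Suc k) * (t - b) / l\<rfloor> div 2" for t b
    using floor_divide_real_eq_div[of 2 "2^(Suc k) * (t - b) / l"] by simp
  show ?thesis
    unfolding dyadic_cell_def half by (intro Collect_mono impI allI) (simp only:)
qed

lemma dyadic_cell_antimono: "j \<le> k \<Longrightarrow> dyadic_cell a l k x \<subseteq> dyadic_cell a l j x"
  by (rule lift_Suc_antimono_le[of "\<lambda>k. dyadic_cell a l k x"]) (rule dyadic_cell_Suc)

lemma dyadic_cell_0:
  assumes "l > 0" "x \<in> cube a l"
  shows "dyadic_cell a l 0 x = cube a l"
proof -
  have "\<lfloor>(x $ i - a $ i) / l\<rfloor> = 0" for i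
    using assms by (auto simp: cube_def floor_eq_iff field_simps)
  then show ?thesis
    using assms by (simp add: dyadic_cell_eq_cube)
qed

lemma dyadic_cell_subset_cube:
  assumes "l > 0" "x \<in> cube a l"
  shows "dyadic_cell a l k x \<subseteq> cube a l"
  using dyadic_cell_antimono[of 0 k a l x] dyadic_cell_0[OF assms] by simp

lemma is_cube_dyadic_cell: "l > 0 \<Longrightarrow> is_cube (dyadic_cell a l k x)"
  unfolding is_cube_def by (intro exI conjI, rule_tac[2] dyadic_cell_eq_cube) auto

lemma countable_dyadic_cells:
  "countable {dyadic_cell a l k x | k x. True}" for a :: "real^'n"
proof -
  have "{dyadic_cell a l k x | k x. True}
      \<subseteq> range (\<lambda>(k, m :: int^'n). {y. \<forall>i. \<lfloor>2^k * (y $ i - a $ i) / l\<rfloor> = m $ i})"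
  proof clarify
    fix k x
    show "dyadic_cell a l k x
      \<in> range (\<lambda>(k, m :: int^'n). {y. \<forall>i. \<lfloor>2^k * (y $ i - a $ i) / l\<rfloor> = m $ i})"
      by (rule image_eqI[of _ _ "(k, \<chi> i. \<lfloor>2^k * (x $ i - a $ i) / l\<rfloor>)"])
         (simp_all add: dyadic_cell_def)
  qed
  then show ?thesis
    by (rule countable_subset) simp
qed

lemma dyadic_cell_in_open:
  fixes x :: "real^'n"
  assumes "l > 0" "open G" "x \<in> G"
  obtains k where "dyadic_cell a l k x \<subseteq> G"
proof -
  obtain e where e: "e > 0" "ball x e \<subseteq> G"
    using assms openE by blast
  obtain k where k: "(1/2)^k < e / (l * CARD('n))"
    using real_arch_pow_inv[of "e / (l * CARD('n))" "1/2"] e assms by auto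
  have "dist x y < e" if y: "y \<in> dyadic_cell a l k x" for y
  proof -
    have "\<bar>x $ i - y $ i\<bar> \<le> l / 2^k" for i
    proof -
      obtain b where "dyadic_cell a l k x = cube b (l / 2^k)"
        using dyadic_cell_eq_cube[OF assms(1)] by blast
      then have "x \<in> cube b (l / 2^k)" "y \<in> cube b (l / 2^k)"
        using y dyadic_cell_self[of x a l k] by simp_all
      then have "b $ i \<le> x $ i" "x $ i < b $ i + l / 2^k" "b $ i \<le> y $ i" "y $ i < b $ i + l / 2^k"
        by (simp_all add: cube_def)
      then show ?thesis by linarith
    qed
    then have "norm (x - y) \<le> (\<Sum>i\<in>(UNIV::'n set). l / 2^k)"
      by (intro order_trans[OF norm_le_l1_cart] sum_mono) simp
    also have "\<dots> < e"
      using k assms by (simp add: field_simps power_divide)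
    finally show ?thesis by (simp add: dist_norm)
  qed
  then have "dyadic_cell a l k x \<subseteq> G" using e by auto
  then show ?thesis by (rule that)
qed

text \<open>
  The stopping-time selection: keep the first, that is largest, cell around each point that has
  the property \<open>P\<close>. If two selected cells meet, they are nested, and the smaller one was selected
  because \<open>P\<close> fails for all its proper ancestors; hence they coincide. The lemma serves twice: to
  write a set as a disjoint union of cubes, and to select the Calderon-Zygmund cubes.
\<close>
lemma stopping_cubes:
  fixes P :: "(real^'n) set \<Rightarrow> bool" and a :: "real^'n"
  assumes l: "l > 0"
  defines "F \<equiv> {dyadic_cell a l k x | k x. x \<in> cube a l \<and> P (dyadic_cell a l k x) \<and>
                  (\<forall>j<k. \<not> P (dyadic_cell a l j x))}"
  shows "countable F" "disjoint F" "\<And>R. R \<in> F \<Longrightarrow> is_cube R \<and> R \<subseteq> cube a l"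
    and "\<Union>F = {x \<in> cube a l. \<exists>k. P (dyadic_cell a l k x)}"
proof -
  show "countable F"
    by (rule countable_subset[OF _ countable_dyadic_cells[of a l]]) (auto simp: F_def)
  show "\<And>R. R \<in> F \<Longrightarrow> is_cube R \<and> R \<subseteq> cube a l"
    unfolding F_def using is_cube_dyadic_cell[OF l] dyadic_cell_subset_cube[OF l] by blast
  have eq: "dyadic_cell a l k x = dyadic_cell a l j y"
    if "z \<in> dyadic_cell a l k x" "z \<in> dyadic_cell a l j y" "k \<le> j"
       "P (dyadic_cell a l k x)" "\<forall>i<j. \<not> P (dyadic_cell a l i y)" for x y z k j
  proof -
    have "z \<in> dyadic_cell a l k y"
      using that dyadic_cell_antimono[OF that(3)] by blast
    then have "dyadic_cell a l k x = dyadic_cell a l k y"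
      using that dyadic_cell_eq by metis
    with that have "k = j" by (metis nat_less_le)
    then show ?thesis using \<open>dyadic_cell a l k x = dyadic_cell a l k y\<close> by simp
  qed
  show "disjoint F"
  proof (rule disjointI)
    fix R S assume "R \<in> F" "S \<in> F" "R \<noteq> S"
    then show "R \<inter> S = {}"
      unfolding F_def by clarsimp (metis (no_types, lifting) disjoint_iff eq nle_le)
  qed
  show "\<Union>F = {x \<in> cube a l. \<exists>k. P (dyadic_cell a l k x)}" (is "_ = ?U")
  proof
    show "\<Union>F \<subseteq> ?U"
    proof
      fix z assume "z \<in> \<Union>F"
      then obtain k x where kx: "z \<in> dyadic_cell a l k x" "x \<in> cube a l" "P (dyadic_cell a l k x)"
        unfolding F_def by blast
      then show "z \<in> ?U"
        using dyadic_cell_eq[OF kx(1)] dyadic_cell_subset_cube[OF l kx(2)]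
        by (metis (mono_tags, lifting) mem_Collect_eq subsetD)
    qed
    show "?U \<subseteq> \<Union>F"
    proof
      fix x assume "x \<in> ?U"
      then have "x \<in> cube a l" and ex: "\<exists>k. P (dyadic_cell a l k x)" by auto
      moreover define k where "k = (LEAST k. P (dyadic_cell a l k x))"
      ultimately have "dyadic_cell a l k x \<in> F"
        unfolding F_def using LeastI_ex[OF ex] not_less_Least by blast
      then show "x \<in> \<Union>F" using dyadic_cell_self by blast
    qed
  qed
qed

text \<open>
  The unions of dyadic subcubes of \<open>cube a l\<close>, described like open sets by their points, which makes
  intersections easy to handle.
\<close>
definition dyadically_open :: "real^'n \<Rightarrow> real \<Rightarrow> (real^'n) set \<Rightarrow> bool" where
  "dyadically_open a l E \<longleftrightarrow> E \<subseteq> cube a l \<and> (\<forall>x\<in>E. \<exists>k. dyadic_cell a l k x \<subseteq> E)"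

lemma dyadically_open_Int_cell:
  assumes "dyadically_open a l E"
  shows "dyadically_open a l (E \<inter> dyadic_cell a l j y)"
  unfolding dyadically_open_def
proof (intro conjI ballI)
  show "E \<inter> dyadic_cell a l j y \<subseteq> cube a l"
    using assms by (auto simp: dyadically_open_def)
next
  fix x assume x: "x \<in> E \<inter> dyadic_cell a l j y"
  then obtain k where k: "dyadic_cell a l k x \<subseteq> E"
    using assms by (auto simp: dyadically_open_def)
  \<comment> \<open>Of two cells around \<open>x\<close> the one of later generation lies in both.\<close>
  have "dyadic_cell a l (max j k) x \<subseteq> dyadic_cell a l k x"
    "dyadic_cell a l (max j k) x \<subseteq> dyadic_cell a l j x"
    by (simp_all add: dyadic_cell_antimono)
  moreover have "dyadic_cell a l j x = dyadic_cell a l j y"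
    using x dyadic_cell_eq by blast
  ultimately show "\<exists>k. dyadic_cell a l k x \<subseteq> E \<inter> dyadic_cell a l j y"
    using k by blast
qed

lemma dyadically_open_Int_open:
  assumes "l > 0" "open G"
  shows "dyadically_open a l (G \<inter> cube a l)"
  unfolding dyadically_open_def
proof (intro conjI ballI)
  fix x assume x: "x \<in> G \<inter> cube a l"
  then obtain k where "dyadic_cell a l k x \<subseteq> G"
    using dyadic_cell_in_open[OF assms] by blast
  then show "\<exists>k. dyadic_cell a l k x \<subseteq> G \<inter> cube a l"
    using dyadic_cell_subset_cube[OF assms(1)] x by blast
qed simp

lemma dyadically_open_decompose:
  assumes l: "l > 0" and E: "dyadically_open a l E"
  obtains F where "countable F" "disjoint F" "\<And>R. R \<in> F \<Longrightarrow> is_cube R \<and> R \<subseteq> E" "\<Union>F = E"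
proof -
  let ?P = "\<lambda>R. R \<subseteq> E"
  let ?F = "{dyadic_cell a l k x | k x. x \<in> cube a l \<and> ?P (dyadic_cell a l k x) \<and>
                  (\<forall>j<k. \<not> ?P (dyadic_cell a l j x))}"
  note F = stopping_cubes[OF l, where P = ?P and a = a]
  have UF: "\<Union>?F = E"
    unfolding F(4) using E dyadic_cell_self unfolding dyadically_open_def by blast
  have "is_cube R \<and> R \<subseteq> E" if "R \<in> ?F" for R
    using F(3)[OF that] that UF by blast
  then show ?thesis
    by (rule that[OF F(1,2) _ UF])
qed

lemma cube_borel: "cube a l \<in> sets borel" for a :: "real^'n"
proof -
  have "cube a l = {x. \<forall>i. a $ i \<le> x $ i} \<inter> (\<Inter>i\<in>UNIV. {x. x $ i < a $ i + l})"
    by (auto simp: cube_def)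
  moreover have "closed {x. \<forall>i. a $ i \<le> x $ i}"
    by (simp add: closed_interval_right_cart)
  moreover have "open (\<Inter>i\<in>UNIV. {x. x $ i < a $ i + l})"
    by (intro open_INT) (auto simp: open_halfspace_component_lt_cart)
  ultimately show ?thesis by (simp only: borel_closed borel_open sets.Int)
qed

lemma is_cube_borel: "is_cube Q \<Longrightarrow> Q \<in> sets borel"
  using cube_borel by (auto simp: is_cube_def)

lemma dyadically_open_borel:
  assumes "l > 0" "dyadically_open a l E"
  shows "E \<in> sets borel"
proof -
  obtain F where F: "countable F" "\<And>R. R \<in> F \<Longrightarrow> is_cube R \<and> R \<subseteq> E" "\<Union>F = E"
    using dyadically_open_decompose[OF assms] by metis
  have "\<Union>F \<in> sets borel"
    using F(1,2) is_cube_borel by (intro sets.countable_Union) auto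
  then show ?thesis using F(3) by simp
qed

section \<open>The Calderon-Zygmund iteration\<close>

lemma emeasure_subset_finite:
  "A \<subseteq> B \<Longrightarrow> B \<in> sets M \<Longrightarrow> emeasure M B < \<infinity> \<Longrightarrow> emeasure M A < \<infinity>"
  by (meson emeasure_mono le_less_trans)

lemma measure_mono_finite:
  "A \<subseteq> B \<Longrightarrow> A \<in> sets M \<Longrightarrow> B \<in> sets M \<Longrightarrow> emeasure M B < \<infinity> \<Longrightarrow> measure M A \<le> measure M B"
  by (intro measure_mono_fmeasurable) (auto simp: fmeasurable_def)

text \<open>
  Local density bounds on disjoint pieces add up to a global one. The iteration uses this twice: to
  bound \<open>N\<close> on the old set by \<open>N\<close> on the new one, and \<open>M\<close> on the new set by \<open>M\<close> on the old one.
\<close>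
lemma measure_Int_Union_le:
  assumes F: "countable F" "disjoint F" "\<And>R. R \<in> F \<Longrightarrow> R \<in> sets M"
    and AB: "A \<in> sets M" "B \<in> sets M" and fin: "emeasure M (\<Union>F) < \<infinity>" and c: "c \<ge> 0"
    and le: "\<And>R. R \<in> F \<Longrightarrow> measure M (A \<inter> R) \<le> c * measure M (B \<inter> R)"
  shows "measure M (A \<inter> \<Union>F) \<le> c * measure M (B \<inter> \<Union>F)"
proof -
  have UF: "\<Union>F \<in> sets M" using F by (intro sets.countable_Union) auto
  have finite: "emeasure M (D \<inter> R) = ennreal (measure M (D \<inter> R))"
    if "R \<subseteq> \<Union>F" for D R
  proof -
    have "D \<inter> R \<subseteq> \<Union>F" using that by blast
    from emeasure_subset_finite[OF this UF fin] show ?thesis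
      by (intro emeasure_eq_ennreal_measure) simp
  qed
  have split: "emeasure M (D \<inter> \<Union>F) = (\<integral>\<^sup>+R. emeasure M (D \<inter> R) \<partial>count_space F)"
    if "D \<in> sets M" for D
  proof -
    have "disjoint_family_on (\<lambda>R. D \<inter> R) F"
      using F(2) by (auto simp: disjoint_family_on_def disjoint_def)
    moreover have "D \<inter> R \<in> sets M" if "R \<in> F" for R
      using \<open>D \<in> sets M\<close> F(3) that by blast
    moreover have "D \<inter> \<Union>F = (\<Union>R\<in>F. D \<inter> R)" by blast
    ultimately show ?thesis
      using emeasure_UN_countable[OF _ F(1), of "\<lambda>R. D \<inter> R" M] by simp
  qed
  have "emeasure M (A \<inter> \<Union>F) \<le> (\<integral>\<^sup>+R. ennreal c * emeasure M (B \<inter> R) \<partial>count_space F)"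
    unfolding split[OF AB(1)] using le c
    by (intro nn_integral_mono) (simp add: finite Union_upper flip: ennreal_mult)
  also have "\<dots> = ennreal c * emeasure M (B \<inter> \<Union>F)"
    by (simp add: split[OF AB(2)] nn_integral_cmult)
  finally show ?thesis
    using c by (simp add: finite ennreal_mult[symmetric])
qed

text \<open>
  The step from \<open>k\<close> to \<open>Suc k\<close> replaces \<open>E\<close> by the union of its Calderon-Zygmund cubes at level
  \<open>lam\<close>: the \<open>M\<close>-measure grows at most by the factor \<open>1 / lam\<close>, the \<open>N\<close>-measure at least
  doubles. The assumption \<open>half\<close> applies inside each selected cube because doubling passes the
  density bound on from the parent with the loss of a factor \<open>D\<close>.
\<close>
lemma decay_dyadically_open:
  fixes M N :: "(real^'n) measure"
  assumes sM: "sets M = sets borel" and sN: "sets N = sets borel"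
    and finM: "\<And>Q. is_cube Q \<Longrightarrow> emeasure M Q < \<infinity>"
    and finN: "\<And>Q. is_cube Q \<Longrightarrow> emeasure N Q < \<infinity>"
    and posM: "\<And>Q. is_cube Q \<Longrightarrow> measure M Q > 0"
    and D: "D > 0" "\<And>a l b m. l > 0 \<Longrightarrow> m = 2 * l \<Longrightarrow> cube a l \<subseteq> cube b m \<Longrightarrow>
              measure M (cube b m) \<le> D * measure M (cube a l)"
    and lam: "0 < lam" "lam < 1"
    and half: "\<And>Q F. is_cube Q \<Longrightarrow> countable F \<Longrightarrow> disjoint F \<Longrightarrow>
         (\<And>R. R \<in> F \<Longrightarrow> is_cube R \<and> R \<subseteq> Q) \<Longrightarrow> measure M (\<Union>F) \<le> D * lam * measure M Q \<Longrightarrow>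
         measure N (\<Union>F) \<le> measure N Q / 2"
    and l: "l > 0"
    and E: "dyadically_open a l E" "measure M E \<le> lam ^ k * measure M (cube a l)"
  shows "measure N E \<le> (1/2) ^ k * measure N (cube a l)"
  using E
proof (induction k arbitrary: E)
  case 0
  have "is_cube (cube a l)" using l by (auto simp: is_cube_def)
  moreover have "E \<subseteq> cube a l" using 0(1) by (simp add: dyadically_open_def)
  ultimately show ?case
    using measure_mono_finite[of E "cube a l" N] finN sN is_cube_borel[of "cube a l"]
      dyadically_open_borel[OF l 0(1)] by simp
next
  case (Suc k)
  let ?Q = "cube a l"
  have Q: "is_cube ?Q" using l by (auto simp: is_cube_def)
  have EQ: "E \<subseteq> ?Q" using Suc by (simp add: dyadically_open_def)
  define P where "P R \<longleftrightarrow> measure M (E \<inter> R) > lam * measure M R" for R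
  define F where "F = {dyadic_cell a l k x | k x. x \<in> ?Q \<and> P (dyadic_cell a l k x) \<and>
                  (\<forall>j<k. \<not> P (dyadic_cell a l j x))}"
  note F = stopping_cubes[OF l, where P = P and a = a, folded F_def]
  have FM: "R \<in> sets M" "R \<in> sets N" if "R \<in> F" for R
    using F(3) that is_cube_borel sM sN by auto
  have UFM: "\<Union>F \<in> sets M" "\<Union>F \<in> sets N"
    using F(1) FM by (intro sets.countable_Union subsetI; simp)+
  have EM: "E \<in> sets M" "E \<in> sets N"
    using dyadically_open_borel[OF l Suc.prems(1)] sM sN by auto
  have UF: "\<Union>F \<subseteq> ?Q" using F(3) by blast
  have fin: "emeasure M (\<Union>F) < \<infinity>" "emeasure N (\<Union>F) < \<infinity>"
    using emeasure_subset_finite[OF UF] finM[OF Q] finN[OF Q] is_cube_borel[OF Q] sM sN by simp_all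
  have cells: "\<exists>k x. R = dyadic_cell a l k x \<and> x \<in> ?Q \<and> P R" if "R \<in> F" for R
    using that unfolding F_def by blast
  have EF: "E \<subseteq> \<Union>F"
  proof
    fix x assume x: "x \<in> E"
    then obtain j where j: "dyadic_cell a l j x \<subseteq> E"
      using Suc.prems(1) by (auto simp: dyadically_open_def)
    have "measure M (dyadic_cell a l j x) > 0"
      by (rule posM[OF is_cube_dyadic_cell[OF l]])
    then have "P (dyadic_cell a l j x)"
      using lam j by (simp add: P_def inf.absorb2)
    then show "x \<in> \<Union>F" unfolding F(4) using x EQ by blast
  qed
  \<comment> \<open>The new set is again of the kind to which the induction hypothesis applies.\<close>
  have DF: "dyadically_open a l (\<Union>F)"
    unfolding dyadically_open_def
  proof (intro conjI ballI UF)
    fix x assume "x \<in> \<Union>F"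
    then obtain j where "dyadic_cell a l j x \<in> F"
      using cells dyadic_cell_eq by (metis UnionE)
    then show "\<exists>k. dyadic_cell a l k x \<subseteq> \<Union>F" by blast
  qed
  \<comment> \<open>The whole cube is not selected, so every selected cube has a parent inside \<open>?Q\<close>.\<close>
  have notQ: "\<not> P ?Q"
  proof -
    have "lam ^ Suc k \<le> lam"
      using lam power_decreasing[of 1 "Suc k" lam] by simp
    then have "measure M E \<le> lam * measure M ?Q"
      using Suc.prems(2) by (meson measure_nonneg mult_right_mono order_trans)
    then show ?thesis using EQ by (simp add: P_def inf.absorb1)
  qed
  have small: "measure M (E \<inter> R) \<le> D * lam * measure M R" if "R \<in> F" for R
  proof -
    from that obtain j x where R: "R = dyadic_cell a l j x" "x \<in> ?Q" "P R"
      "\<forall>i<j. \<not> P (dyadic_cell a l i x)"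
      unfolding F_def by blast
    have "j \<noteq> 0" using R(1,3) notQ dyadic_cell_0[OF l R(2)] by metis
    then obtain i where i: "j = Suc i" using not0_implies_Suc by blast
    let ?S = "dyadic_cell a l i x"
    have sub: "R \<subseteq> ?S" unfolding R i by (rule dyadic_cell_Suc)
    have "measure M ?S \<le> D * measure M R"
      using sub l unfolding R i by (simp add: dyadic_cell_eq_cube[OF l] D(2) del: of_int_floor_cancel)
    moreover have "measure M (E \<inter> ?S) \<le> lam * measure M ?S"
      using R(4) i by (auto simp: P_def)
    moreover have "measure M (E \<inter> R) \<le> measure M (E \<inter> ?S)"
    proof (rule measure_mono_finite)
      have cell: "?S \<in> sets M" "R \<in> sets M" "emeasure M ?S < \<infinity>"
        using finM[OF is_cube_dyadic_cell[OF l]] is_cube_borel[OF is_cube_dyadic_cell[OF l]] sM R(1)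
        by simp_all
      then show "E \<inter> R \<in> sets M" "E \<inter> ?S \<in> sets M" using EM by auto
      show "emeasure M (E \<inter> ?S) < \<infinity>"
        by (rule emeasure_subset_finite[OF _ cell(1,3)]) simp
    qed (use sub in auto)
    ultimately have "measure M (E \<inter> R) \<le> lam * (D * measure M R)"
      using lam(1) by (meson less_imp_le mult_left_mono order_trans)
    then show ?thesis by (simp add: mult_ac)
  qed
  have halves: "measure N (E \<inter> R) \<le> (1/2) * measure N (\<Union>F \<inter> R)" if RF: "R \<in> F" for R
  proof -
    obtain j x where R: "R = dyadic_cell a l j x" using cells[OF RF] by blast
    have "dyadically_open a l (E \<inter> R)"
      unfolding R by (rule dyadically_open_Int_cell[OF Suc.prems(1)])
    then obtain H where H: "countable H" "disjoint H" "\<And>S. S \<in> H \<Longrightarrow> is_cube S \<and> S \<subseteq> E \<inter> R"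
      "\<Union>H = E \<inter> R"
      using dyadically_open_decompose[OF l] by metis
    have "measure N (\<Union>H) \<le> measure N R / 2"
      using H small[OF that] F(3)[OF that] by (intro half) auto
    moreover have "\<Union>F \<inter> R = R" using that by blast
    ultimately show ?thesis using H(4) by simp
  qed
  have "measure M (\<Union>F \<inter> \<Union>F) \<le> 1 / lam * measure M (E \<inter> \<Union>F)"
  proof (rule measure_Int_Union_le)
    fix R assume R: "R \<in> F"
    then have "P R" using cells by blast
    moreover have "\<Union>F \<inter> R = R" using R by blast
    ultimately show "measure M (\<Union>F \<inter> R) \<le> 1 / lam * measure M (E \<inter> R)"
      using lam by (simp add: P_def field_simps)
  qed (use F(1,2) FM EM UFM fin lam in simp_all)
  then have "measure M (\<Union>F) \<le> lam ^ k * measure M ?Q"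
  proof -
    assume "measure M (\<Union>F \<inter> \<Union>F) \<le> 1 / lam * measure M (E \<inter> \<Union>F)"
    then have "lam * measure M (\<Union>F) \<le> measure M E"
      using EF lam by (simp add: inf.absorb1 field_simps)
    also have "\<dots> \<le> lam * (lam ^ k * measure M ?Q)"
      using Suc.prems(2) by (simp add: mult.assoc)
    finally show ?thesis
      using lam(1) by simp
  qed
  then have IH: "measure N (\<Union>F) \<le> (1/2) ^ k * measure N ?Q"
    by (rule Suc.IH[OF DF])
  have "measure N (E \<inter> \<Union>F) \<le> 1/2 * measure N (\<Union>F \<inter> \<Union>F)"
    by (rule measure_Int_Union_le) (use F(1,2) FM EM UFM fin halves in simp_all)
  then show ?case
    using IH EF by (simp add: inf.absorb1)
qed

section \<open>The weight as a measure\<close>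

lemma cube_subset_cbox: "cube a l \<subseteq> cbox a (\<chi> i. a $ i + l)"
  by (auto simp: cube_def mem_box_cart less_imp_le)

lemma emeasure_compact_finite:
  assumes "sets M = sets borel" "locally_finite_measure M" "compact K"
  shows "emeasure M K < \<infinity>"
proof -
  obtain U where U: "\<And>x. open (U x)" "\<And>x. x \<in> U x" "\<And>x. emeasure M (U x) < \<infinity>"
    using assms(2) unfolding locally_finite_measure_def by metis
  have "K \<subseteq> (\<Union>x\<in>K. U x)" using U(2) by blast
  from compactE_image[OF assms(3) U(1) this]
  obtain T where T: "finite T" "K \<subseteq> (\<Union>x\<in>T. U x)" .
  have "emeasure M K \<le> emeasure M (\<Union>x\<in>T. U x)"
    using U(1) T assms(1) by (intro emeasure_mono) auto
  also have "\<dots> \<le> (\<Sum>x\<in>T. emeasure M (U x))"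
    using U(1) T(1) assms(1) by (intro emeasure_subadditive_finite) auto
  also have "\<dots> < \<infinity>" using U(3) T(1) by simp
  finally show ?thesis .
qed

lemma wmeas_eq_measure_density:
  assumes "weight M w" "E \<in> sets M"
  shows "wmeas M w E = measure (density M (\<lambda>x. ennreal (w x))) E"
proof -
  have w[measurable]: "w \<in> borel_measurable M" "\<And>x. w x \<ge> 0"
    using assms by (auto simp: weight_def locally_integrable_def)
  have "wmeas M w E = enn2real (\<integral>\<^sup>+x. ennreal (indicator E x *\<^sub>R w x) \<partial>M)"
    unfolding wmeas_def set_lebesgue_integral_def using w assms(2)
    by (intro integral_eq_nn_integral) auto
  also have "(\<integral>\<^sup>+x. ennreal (indicator E x *\<^sub>R w x) \<partial>M) = (\<integral>\<^sup>+x. ennreal (w x) * indicator E x \<partial>M)"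
    by (intro nn_integral_cong) (auto simp: indicator_def)
  also have "\<dots> = emeasure (density M (\<lambda>x. ennreal (w x))) E"
    using w assms by (subst emeasure_density) auto
  finally show ?thesis by (simp add: measure_def)
qed

lemma emeasure_weight_cube_finite:
  assumes "sets M = sets borel" "weight M w"
  shows "emeasure (density M (\<lambda>x. ennreal (w x))) (cube a l) < \<infinity>"
proof -
  let ?K = "cbox a (\<chi> i. a $ i + l)" and ?N = "density M (\<lambda>x. ennreal (w x))"
  have w: "w \<in> borel_measurable M" "\<And>x. w x \<ge> 0" "set_integrable M ?K w"
    using assms by (auto simp: weight_def locally_integrable_def)
  have "emeasure ?N ?K = (\<integral>\<^sup>+x. ennreal (w x) * indicator ?K x \<partial>M)"
    using w assms by (subst emeasure_density) auto
  also have "\<dots> = (\<integral>\<^sup>+x. ennreal (norm (indicator ?K x *\<^sub>R w x)) \<partial>M)"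
    using w by (intro nn_integral_cong) (auto simp: indicator_def)
  also have "\<dots> < \<infinity>"
    using w(3) unfolding set_integrable_def integrable_iff_bounded by simp
  finally show ?thesis
    using emeasure_subset_finite[OF cube_subset_cbox, of a l ?N] assms(1) by simp
qed

section \<open>The power bound\<close>

text \<open>
  Outer regularity holds for finite measures, whence the restriction of \<open>M\<close> to \<open>Q\<close> in the proof.
\<close>
lemma outer_open_approx:
  fixes M :: "(real^'n) measure"
  assumes sM: "sets M = sets borel" and Q: "Q \<in> sets M" "emeasure M Q < \<infinity>"
    and E: "E \<in> sets M" "E \<subseteq> Q" and s: "measure M E < s"
  obtains G where "open G" "E \<subseteq> G" "measure M (G \<inter> Q) < s"
proof -
  let ?R = "density M (indicator Q)"
  have R: "emeasure ?R A = emeasure M (A \<inter> Q)" if "A \<in> sets borel" for A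
  proof -
    have "emeasure ?R A = (\<integral>\<^sup>+x. indicator Q x * indicator A x \<partial>M)"
      using that Q sM by (intro emeasure_density) auto
    also have "\<dots> = (\<integral>\<^sup>+x. indicator (A \<inter> Q) x \<partial>M)"
      by (intro nn_integral_cong) (simp add: indicator_inter_arith mult.commute)
    also have "\<dots> = emeasure M (A \<inter> Q)"
      using that Q sM by (intro nn_integral_indicator) auto
    finally show ?thesis .
  qed
  have EQ: "emeasure M E = ennreal (measure M E)"
    using emeasure_subset_finite[OF E(2) Q] by (intro emeasure_eq_ennreal_measure) auto
  have "space M = UNIV" using sM sets_eq_imp_space_eq by fastforce
  then have "emeasure ?R (space ?R) \<noteq> \<infinity>"
    using R[of UNIV] Q by simp
  then have "emeasure ?R E = (INF U \<in> {U. E \<subseteq> U \<and> open U}. emeasure ?R U)"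
    using E sM by (intro outer_regular) auto
  then have "(INF U \<in> {U. E \<subseteq> U \<and> open U}. emeasure ?R U) < ennreal s"
    using R[of E] E sM s EQ by (simp add: inf.absorb1 ennreal_less_iff)
  then obtain G where G: "E \<subseteq> G" "open G" "emeasure ?R G < ennreal s"
    unfolding INF_less_iff by blast
  then have "emeasure M (G \<inter> Q) < ennreal s" by (simp add: R)
  moreover from this have "emeasure M (G \<inter> Q) = ennreal (measure M (G \<inter> Q))"
    by (intro emeasure_eq_ennreal_measure) auto
  ultimately have "measure M (G \<inter> Q) < s"
    by (simp add: ennreal_less_iff)
  then show ?thesis using G that by blast
qed

text \<open>
  The exponent is chosen such that \<open>lam^k\<close> raised to it is \<open>(1/2)^k\<close>. Only the powers of \<open>lam\<close>
  strictly above \<open>t\<close> give information, which loses one step of the decay; this is the factor \<open>2\<close>.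
\<close>
lemma power_decay_imp_powr:
  fixes t r lam :: real
  assumes lam: "0 < lam" "lam < 1" and t: "0 \<le> t" and r: "r \<le> 1"
    and decay: "\<And>k::nat. t < lam ^ k \<Longrightarrow> r \<le> (1/2) ^ k"
  shows "r \<le> 2 * t powr (log lam (1/2))"
proof (cases "t = 0")
  case True
  then have "\<forall>k. r \<le> (1/2) ^ k" using decay lam by simp
  then have "r \<le> 0"
    using real_arch_pow_inv[of r "1/2"] by (force simp: not_le[symmetric])
  then show ?thesis using True by simp
next
  case False
  then have t: "0 < t" using t by simp
  let ?d = "log lam (1/2)"
  have d: "?d > 0" "lam powr ?d = 1/2"
    using lam by (auto simp: log_def divide_neg_neg powr_def)
  have ex: "\<exists>k. lam ^ k \<le> t" using real_arch_pow_inv[OF t lam(2)] less_imp_le by blast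
  define k where "k = (LEAST k. lam ^ k \<le> t)"
  have k: "lam ^ k \<le> t" unfolding k_def by (rule LeastI_ex[OF ex])
  have "(1/2) ^ k = (lam ^ k) powr ?d"
    using d lam by (metis powr_realpow powr_powr mult.commute zero_less_divide_1_iff zero_less_numeral)
  also have "\<dots> \<le> t powr ?d"
    using k d lam by (intro powr_mono2) auto
  finally have *: "(1/2) ^ k \<le> t powr ?d" .
  show ?thesis
  proof (cases k)
    case 0
    then show ?thesis using * r by simp
  next
    case (Suc j)
    then have "t < lam ^ j"
      using not_less_Least[of j "\<lambda>k. lam ^ k \<le> t"] unfolding k_def by auto
    then have "r \<le> (1/2) ^ j" by (rule decay)
    then show ?thesis using * Suc by simp
  qed
qed

text \<open>
  Monotonicity alone gives an interval from \<open>0\<close> on which the inverse is at most \<open>e\<close>: its right end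
  point is the image of \<open>e\<close>, cut off at \<open>1\<close>.
\<close>
lemma small_inv_of_increasing_bijection:
  fixes \<Phi> :: "real \<Rightarrow> real"
  assumes bij: "bij_betw \<Phi> {0..1} {0..1}" and mono: "strict_mono_on {0..1} \<Phi>" and e: "e > 0"
  obtains \<beta> where "0 < \<beta>" "\<beta> \<le> 1" "\<And>t. 0 \<le> t \<Longrightarrow> t \<le> \<beta> \<Longrightarrow> inv_into {0..1} \<Phi> t \<le> e"
proof -
  define s where "s = min 1 e"
  have s: "s \<in> {0..1}" "0 < s" using e by (auto simp: s_def)
  have im: "\<Phi> x \<in> {0..1}" if "x \<in> {0..1}" for x using bij that bij_betwE by blast
  have "\<Phi> 0 < \<Phi> s" using mono s by (auto simp: strict_mono_on_def)
  then have "0 < \<Phi> s" "\<Phi> s \<le> 1" using im[of 0] im[of s] s by auto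
  moreover have "inv_into {0..1} \<Phi> t \<le> e" if t: "0 \<le> t" "t \<le> \<Phi> s" for t
  proof -
    have "t \<in> \<Phi> ` {0..1}" using t \<open>\<Phi> s \<le> 1\<close> bij by (auto simp: bij_betw_def)
    then have "\<Phi> (inv_into {0..1} \<Phi> t) = t" "inv_into {0..1} \<Phi> t \<in> {0..1}"
      by (rule f_inv_into_f, rule inv_into_into)
    then have "inv_into {0..1} \<Phi> t \<le> s"
      using mono t s unfolding strict_mono_on_def by (metis not_le)
    then show ?thesis by (simp add: s_def)
  qed
  ultimately show ?thesis by (rule that)
qed

theorem corollary4p1:
  fixes M :: "(real^'n) measure" and w :: "real^'n \<Rightarrow> real"
    and \<Phi> :: "real \<Rightarrow> real" and C :: real
  assumes "doubling_measure M"
    and "weight M w"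
    and "bij_betw \<Phi> {0..1} {0..1}" and "strict_mono_on {0..1} \<Phi>"
    and "C > 0"
    and "\<And>Q F. is_cube Q \<Longrightarrow> countable F \<Longrightarrow> disjoint F \<Longrightarrow> (\<And>R. R \<in> F \<Longrightarrow> is_cube R \<and> R \<subseteq> Q) \<Longrightarrow>
           wmeas M w (\<Union>F) / wmeas M w Q \<le> C * inv_into {0..1} \<Phi> (measure M (\<Union>F) / measure M Q)"
  shows "w \<in> A_infty M"
proof -
  define N where "N = density M (\<lambda>x. ennreal (w x))"
  have sM: "sets M = sets borel" and lf: "locally_finite_measure M"
    using assms(1) unfolding doubling_measure_def by simp_all
  then have sN: "sets N = sets borel"
    by (simp add: N_def)
  have wN: "wmeas M w E = measure N E" if "E \<in> sets borel" for E
    unfolding N_def using wmeas_eq_measure_density[OF assms(2)] that sM by simp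
  have finM: "emeasure M Q < \<infinity>" and finN: "emeasure N Q < \<infinity>" if cubeQ: "is_cube Q" for Q
  proof -
    obtain a l where Q: "Q = cube a l" using cubeQ unfolding is_cube_def by blast
    show "emeasure N Q < \<infinity>"
      unfolding N_def Q by (rule emeasure_weight_cube_finite[OF sM assms(2)])
    show "emeasure M Q < \<infinity>"
      unfolding Q using emeasure_subset_finite[OF cube_subset_cbox, of a l M] sM
        emeasure_compact_finite[OF sM lf compact_cbox] by simp
  qed
  have posN: "measure N Q > 0" if "is_cube Q" for Q
    using assms(2) wN[OF is_cube_borel[OF that]] that by (auto simp: weight_def)
  \<comment> \<open>A cube that is null for \<open>M\<close> would carry no weight.\<close>
  have posM: "measure M Q > 0" if "is_cube Q" for Q
  proof (rule ccontr)
    assume "\<not> measure M Q > 0"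
    then have "measure M Q = 0" using measure_nonneg[of M Q] by linarith
    then have "emeasure M Q = 0"
      using finM[OF that] by (simp add: emeasure_eq_ennreal_measure)
    then have "Q \<in> null_sets M" using is_cube_borel[OF that] sM by auto
    moreover have "w \<in> borel_measurable M"
      using assms(2) by (auto simp: weight_def locally_integrable_def)
    ultimately have "Q \<in> null_sets N"
      unfolding N_def using absolutely_continuousI_density[of "\<lambda>x. ennreal (w x)" M]
      by (auto simp: absolutely_continuous_def)
    then have "measure N Q = 0" by (simp add: measure_eq_0_null_sets)
    then show False using posN[OF that] by simp
  qed
  obtain c \<nu> where c: "c \<ge> 1" "\<nu> > 0" and doubling: "\<forall>a l b m. l > 0 \<and> m > 0 \<and>
      cube a l \<subseteq> cube b m \<longrightarrow> measure M (cube b m) \<le> c * (m / l) powr \<nu> * measure M (cube a l)"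
    using assms(1) unfolding doubling_measure_def by (elim conjE exE)
  \<comment> \<open>the doubling constant for a cube and a subcube of half its side\<close>
  define D where "D = c * 2 powr \<nu>"
  have D: "D > 1"
  proof -
    have "1 < (2::real) powr \<nu>" using c(2) by simp
    then show ?thesis unfolding D_def using c(1) less_le_trans[of 1 "2 powr \<nu>" "c * 2 powr \<nu>"] by simp
  qed
  obtain \<beta> where \<beta>: "0 < \<beta>" "\<beta> \<le> 1"
      "\<And>t. 0 \<le> t \<Longrightarrow> t \<le> \<beta> \<Longrightarrow> inv_into {0..1} \<Phi> t \<le> 1 / (2 * C)"
    using small_inv_of_increasing_bijection[OF assms(3,4), of "1 / (2 * C)"] \<open>C > 0\<close> by auto
  define lam where "lam = \<beta> / D"
  have lam: "0 < lam" "lam < 1" "D * lam = \<beta>"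
    using \<beta> D by (auto simp: lam_def)
  have half: "measure N (\<Union>F) \<le> measure N Q / 2"
    if "is_cube Q" "countable F" "disjoint F" "\<And>R. R \<in> F \<Longrightarrow> is_cube R \<and> R \<subseteq> Q"
      "measure M (\<Union>F) \<le> D * lam * measure M Q" for Q F
  proof -
    have UF: "\<Union>F \<in> sets borel"
      using that is_cube_borel by (intro sets.countable_Union) auto
    have "inv_into {0..1} \<Phi> (measure M (\<Union>F) / measure M Q) \<le> 1 / (2 * C)"
      using that(5) posM[OF that(1)] lam(3) by (intro \<beta>(3)) (auto simp: field_simps)
    then have "C * inv_into {0..1} \<Phi> (measure M (\<Union>F) / measure M Q) \<le> 1 / 2"
      using \<open>C > 0\<close> by (simp add: field_simps)
    moreover have "measure N (\<Union>F) / measure N Q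
        \<le> C * inv_into {0..1} \<Phi> (measure M (\<Union>F) / measure M Q)"
      using assms(6)[OF that(1-4)] unfolding wN[OF UF] wN[OF is_cube_borel[OF that(1)]] .
    ultimately have "measure N (\<Union>F) / measure N Q \<le> 1 / 2"
      by (rule order_trans[rotated])
    then show ?thesis using posN[OF that(1)] by (simp add: field_simps)
  qed
  have main: "wmeas M w E / wmeas M w Q \<le> 2 * (measure M E / measure M Q) powr (log lam (1/2))"
    if Q: "is_cube Q" and E: "E \<in> sets M" "E \<subseteq> Q" for Q E
  proof -
    obtain a l where al: "l > 0" "Q = cube a l" using Q unfolding is_cube_def by blast
    have meas: "E \<in> sets borel" "Q \<in> sets borel" using E sM is_cube_borel[OF Q] by auto
    have N_mono: "measure N A \<le> measure N B" if "A \<subseteq> B" "A \<in> sets borel" "B \<in> sets borel" "B \<subseteq> Q" for A B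
      using that meas sN finN[OF Q] emeasure_subset_finite[of B Q N]
      by (intro measure_mono_finite) auto
    have "measure N E / measure N Q \<le> 2 * (measure M E / measure M Q) powr (log lam (1/2))"
    proof (rule power_decay_imp_powr[OF lam(1,2)])
      show "0 \<le> measure M E / measure M Q" by simp
      show "measure N E / measure N Q \<le> 1"
        using N_mono[OF E(2)] meas posN[OF Q] by simp
    next
      fix k assume "measure M E / measure M Q < lam ^ k"
      then have "measure M E < lam ^ k * measure M Q"
        using posM[OF Q] by (simp add: field_simps)
      \<comment> \<open>The strict inequality leaves room for enlarging \<open>E\<close> to an open set.\<close>
      then obtain G where G: "open G" "E \<subseteq> G" "measure M (G \<inter> Q) < lam ^ k * measure M Q"
        using outer_open_approx[OF sM _ finM[OF Q] E] meas sM by blast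
      have "measure N E \<le> measure N (G \<inter> Q)"
        using G E meas by (intro N_mono) auto
      also have "\<dots> \<le> (1/2) ^ k * measure N (cube a l)"
      proof (rule decay_dyadically_open[OF sM sN finM finN posM _ _ lam(1,2) half al(1)])
        show "dyadically_open a l (G \<inter> Q)"
          unfolding al(2) by (rule dyadically_open_Int_open[OF al(1) G(1)])
        show "measure M (cube b m) \<le> D * measure M (cube a l)"
          if "l > 0" "m = 2 * l" "cube a l \<subseteq> cube b m" for a b :: "real^'n" and l m
          using doubling[rule_format, of l m a b] that by (simp add: D_def)
      qed (use G(3) D al(2) in simp_all)
      finally show "measure N E / measure N Q \<le> (1/2) ^ k"
        using posN[OF Q] al by (simp add: field_simps)
    qed
    then show ?thesis using wN meas by simp
  qed
  show ?thesis
    unfolding A_infty_def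
  proof (intro CollectI conjI exI allI impI)
    show "log lam (1/2) > 0" using lam by (simp add: log_def divide_neg_neg)
    show "(2::real) > 0" by simp
    show "weight M w" by (rule assms(2))
    fix Q E assume "is_cube Q \<and> E \<in> sets M \<and> E \<subseteq> Q"
    then show "wmeas M w E / wmeas M w Q \<le> 2 * (measure M E / measure M Q) powr (log lam (1/2))"
      by (elim conjE) (rule main)
  qed
qed

end
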